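(* Let $G=(V,E)$ be a directed graph, and suppose $S,T\subseteq V$ are such that $\rho_G(S,T)=\rho^\star(G)$. Then \[\rho^\star(G)\ \geq\ \max\left(\sqrt{\frac{|S|}{|T|}},\ \sqrt{\frac{|T|}{|S|}}\right).\]
   Context: For an unweighted directed graph $G=(V,E)$ and nonempty $S,T\subseteq V$ (not necessarily disjoint), let $E(S,T)$ be the set of edges directed from a vertex of $S$ to a vertex of $T$, and define the density $\rho_G(S,T)=\frac{|E(S,T)|}{\sqrt{|S||T|}}$. Let $\rho^\star(G)=\max_{S,T}\rho_G(S,T)$, the maximum over such $S,T$.
   Formalization: The graph is additionally assumed to have at least one edge; in a nonempty graph without edges every density is 0 while the right-hand side is at least 1, so the claim fails there. *)

theory Defs
  imports Complex_Main "Graph_Theory.Pair_Digraph"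
begin

text \<open>
  An unweighted directed graph is a finite \<^term>\<open>G :: 'a pair_pre_digraph\<close> whose edge set is a
  set of ordered pairs of vertices (\<^const>\<open>pair_fin_digraph\<close>): there are no parallel edges, and
  antiparallel edges and self-loops are allowed.
\<close>

definition edges_from_to :: "'a pair_pre_digraph \<Rightarrow> 'a set \<Rightarrow> 'a set \<Rightarrow> ('a \<times> 'a) set" where
  "edges_from_to G S T = {e \<in> parcs G. fst e \<in> S \<and> snd e \<in> T}"

definition density :: "'a pair_pre_digraph \<Rightarrow> 'a set \<Rightarrow> 'a set \<Rightarrow> real" where
  "density G S T = real (card (edges_from_to G S T)) / sqrt (real (card S) * real (card T))"

text \<open>
  \<^const>\<open>Max\<close> is the true maximum whenever the vertex set is finite and nonempty, see
  \<open>density_le_max_density\<close> and \<open>max_density_attained\<close>.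
\<close>

definition max_density :: "'a pair_pre_digraph \<Rightarrow> real" where
  "max_density G =
     Max {density G S T | S T. S \<subseteq> pverts G \<and> T \<subseteq> pverts G \<and> S \<noteq> {} \<and> T \<noteq> {}}"

lemma finite_densities:
  assumes "finite (pverts G)"
  shows "finite {density G S T | S T. S \<subseteq> pverts G \<and> T \<subseteq> pverts G \<and> S \<noteq> {} \<and> T \<noteq> {}}"
proof (rule finite_subset)
  show "{density G S T | S T. S \<subseteq> pverts G \<and> T \<subseteq> pverts G \<and> S \<noteq> {} \<and> T \<noteq> {}}
      \<subseteq> (\<lambda>(S, T). density G S T) ` (Pow (pverts G) \<times> Pow (pverts G))"
    by auto
  show "finite ((\<lambda>(S, T). density G S T) ` (Pow (pverts G) \<times> Pow (pverts G)))"
    using assms by simp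
qed

lemma density_le_max_density:
  assumes "finite (pverts G)" "S \<subseteq> pverts G" "T \<subseteq> pverts G" "S \<noteq> {}" "T \<noteq> {}"
  shows "density G S T \<le> max_density G"
  unfolding max_density_def using assms by (intro Max_ge finite_densities) auto

lemma max_density_attained:
  assumes "finite (pverts G)" "pverts G \<noteq> {}"
  obtains S T where "S \<subseteq> pverts G" "T \<subseteq> pverts G" "S \<noteq> {}" "T \<noteq> {}"
    "density G S T = max_density G"
proof -
  have "max_density G \<in> {density G S T | S T.
      S \<subseteq> pverts G \<and> T \<subseteq> pverts G \<and> S \<noteq> {} \<and> T \<noteq> {}}"
    unfolding max_density_def using assms by (intro Max_in finite_densities) auto
  then show thesis using that by (smt (verit) mem_Collect_eq)
qed

end

theory Submission
  imports Defs
begin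

text \<open>
  Vertices of \<open>S\<close> without an edge into \<open>T\<close> can be dropped without losing edges, so at the
  maximum every vertex of \<open>S\<close> has such an edge and \<open>|E(S,T)| \<ge> |S|\<close>; symmetrically
  \<open>|E(S,T)| \<ge> |T|\<close>. Dividing by \<open>sqrt (|S||T|)\<close> gives both bounds.
\<close>

text \<open>The endpoints of any edge, taken as singletons, have density 1. Positivity rules out a
  maximizing pair with no edges between its sides.\<close>

lemma max_density_pos:
  assumes "pair_fin_digraph G" "parcs G \<noteq> {}"
  shows "max_density G > 0"
proof -
  interpret pair_fin_digraph G by fact
  obtain u v where uv: "(u, v) \<in> parcs G" using assms(2) by auto
  then have "u \<in> pverts G" "v \<in> pverts G"
    using in_arcsD1 in_arcsD2 by auto
  then have "density G {u} {v} \<le> max_density G"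
    using finite_verts by (intro density_le_max_density) auto
  moreover have "edges_from_to G {u} {v} = {(u, v)}"
    using uv by (auto simp: edges_from_to_def)
  ultimately show ?thesis by (simp add: density_def)
qed

lemma finite_edges_from_to: "finite (parcs G) \<Longrightarrow> finite (edges_from_to G S T)"
  by (simp add: edges_from_to_def)

text \<open>Equal edge sets give both densities the same numerator, which is positive and cancels;
  the inequality between the densities then reverses into one between the denominators.\<close>

lemma card_mult_le_card_mult_of_density_le:
  assumes "density G S' T' \<le> density G S T" "edges_from_to G S' T' = edges_from_to G S T"
    and "density G S T > 0" "card S' > 0" "card T' > 0"
  shows "card S * card T \<le> card S' * card T'"
proof -
  let ?e = "real (card (edges_from_to G S T))"
  have e: "?e > 0"
    using assms(3) by (intro gr0I of_nat_0_less_iff[THEN iffD2]) (simp add: density_def)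
  have "sqrt (real (card S) * real (card T)) > 0"
    using assms(3) e by (simp add: density_def zero_less_divide_iff)
  moreover have "sqrt (real (card S') * real (card T')) > 0"
    using assms(4,5) by simp
  ultimately have "sqrt (real (card S) * real (card T)) \<le> sqrt (real (card S') * real (card T'))"
    using assms(1,2) e by (simp add: density_def divide_le_cancel frac_le_eq field_simps)
  then show ?thesis
    by (simp flip: of_nat_mult)
qed

lemma card_le_card_edges_from_to:
  assumes "pair_fin_digraph G" "parcs G \<noteq> {}"
    and S: "S \<subseteq> pverts G" "S \<noteq> {}" and T: "T \<subseteq> pverts G" "T \<noteq> {}"
    and max: "density G S T = max_density G"
  shows "card S \<le> card (edges_from_to G S T)" "card T \<le> card (edges_from_to G S T)"
proof -
  interpret pair_fin_digraph G by fact
  let ?E = "edges_from_to G S T"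
  \<comment> \<open>The tails and the heads of the edges in \<open>?E\<close>: exactly the vertices
    of \<open>S\<close> and of \<open>T\<close> that survive the pruning.\<close>
  define S' T' where "S' = fst ` ?E" and "T' = snd ` ?E"
  have pos: "density G S T > 0"
    using max_density_pos[OF assms(1,2)] max by simp
  then have "?E \<noteq> {}"
    by (auto simp: density_def)
  then have ne: "S' \<noteq> {}" "T' \<noteq> {}"
    by (auto simp: S'_def T'_def)
  have sub: "S' \<subseteq> S" "T' \<subseteq> T"
    by (auto simp: S'_def T'_def edges_from_to_def)
  have fin: "finite ?E" "finite S" "finite T"
    using S T finite_verts finite_arcs by (auto intro: finite_edges_from_to finite_subset)
  have card_pos: "card S' > 0" "card T' > 0" "card S > 0" "card T > 0"
    using ne sub fin S T by (auto simp: card_gt_0_iff intro: finite_subset)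
  have eq: "edges_from_to G S' T = ?E" "edges_from_to G S T' = ?E"
    by (force simp: S'_def T'_def edges_from_to_def)+
  have le: "density G S' T \<le> density G S T" "density G S T' \<le> density G S T"
    unfolding max using S T sub ne finite_verts by (auto intro!: density_le_max_density)
  \<comment> \<open>Only the first side was shrunk, so the common positive factor
    \<open>card T\<close> cancels from the product inequality.\<close>
  have "card S \<le> card S'"
    using card_mult_le_card_mult_of_density_le[OF le(1) eq(1) pos] card_pos by simp
  also have "\<dots> \<le> card ?E"
    unfolding S'_def using fin(1) by (rule card_image_le)
  finally show "card S \<le> card ?E" .
  have "card T \<le> card T'"
    using card_mult_le_card_mult_of_density_le[OF le(2) eq(2) pos] card_pos by simp
  also have "\<dots> \<le> card ?E"
    unfolding T'_def using fin(1) by (rule card_image_le)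
  finally show "card T \<le> card ?E" .
qed

text \<open>Since \<open>x / sqrt x = sqrt x\<close>, also at 0, both sides are
  \<open>sqrt x / sqrt y\<close>. This puts the square-root ratios over the denominator of
  \<open>density\<close>.\<close>

lemma sqrt_divide_eq_divide_sqrt:
  assumes "(x::real) \<ge> 0"
  shows "sqrt (x / y) = x / sqrt (x * y)"
  using assms by (simp add: real_sqrt_mult real_sqrt_divide real_div_sqrt flip: divide_divide_eq_left)

theorem lemma3p4:
  fixes G :: "'a pair_pre_digraph" and S T :: "'a set"
  assumes "pair_fin_digraph G"
    and "parcs G \<noteq> {}"
    and "S \<subseteq> pverts G" and "T \<subseteq> pverts G"
    and "S \<noteq> {}" and "T \<noteq> {}"
    and "density G S T = max_density G"
  shows "max_density G \<ge>
    max (sqrt (real (card S) / real (card T))) (sqrt (real (card T) / real (card S)))"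
proof -
  note le = card_le_card_edges_from_to[OF assms(1-3,5,4,6,7)]
  \<comment> \<open>Over the common denominator \<open>sqrt (|S||T|)\<close> only the numerators
    \<open>|S|\<close> and \<open>|E(S,T)|\<close> remain to be compared.\<close>
  have "sqrt (real (card S) / real (card T)) \<le> density G S T"
    using le(1) by (simp add: sqrt_divide_eq_divide_sqrt density_def divide_right_mono)
  moreover have "sqrt (real (card T) / real (card S)) \<le> density G S T"
    using le(2)
    by (simp add: sqrt_divide_eq_divide_sqrt density_def divide_right_mono
        mult.commute[of "real (card T)"])
  ultimately show ?thesis
    using assms(7) by simp
qed

end
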